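(* For every integer $n\ge 4$, the function $a\mapsto \mathcal{L}(K_{a,n-a})$, defined for integers $0\le a\le \lfloor n/2\rfloor$, attains its unique minimum at $a=\lfloor n/2\rfloor$.
   Context: Uniform sequential attachment process: $G_1=K_1$, and for $t\ge 2$ the random graph $G_t$ is obtained from $G_{t-1}$ (which has $t-1$ vertices) as follows: choose $k$ uniformly from $\{0,1,\dots,t-1\}$, then choose a $k$-element subset $W$ of $V(G_{t-1})$ uniformly at random, then add a new vertex adjacent to exactly the vertices of $W$; all choices are independent across steps. For a finite simple undirected graph $G$ on $n$ vertices, its likelihood is $\mathcal{L}(G)=\Pr[G_n\cong G]$. $K_{a,b}$ is the complete bipartite graph with parts of sizes $a$ and $b$; $K_{0,n}$ is the edgeless graph $\overline{K_n}$ on $n$ vertices. *)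

theory Defs
  imports "HOL-Probability.Probability_Mass_Function" "Graph_Theory.Graph_Theory"
begin

text \<open>
  A simple undirected graph is a \<^locale>\<open>pair_graph\<close>: a finite vertex set with a symmetric
  irreflexive set of arcs, an edge between \<open>u\<close> and \<open>v\<close> being the two arcs \<open>(u, v)\<close> and \<open>(v, u)\<close>.
\<close>

definition attach_vertex :: "'a \<Rightarrow> 'a set \<Rightarrow> 'a pair_pre_digraph \<Rightarrow> 'a pair_pre_digraph" where
  "attach_vertex v W G =
     \<lparr>pverts = insert v (pverts G), parcs = parcs G \<union> {v} \<times> W \<union> W \<times> {v}\<rparr>"

text \<open>
  The distribution of \<open>G\<^sub>t\<close>, where \<open>G\<^sub>t\<close> lives on the vertices \<open>1, \<dots>, t\<close> in order of arrival. The process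
  starts at \<open>G\<^sub>1 = K\<^sub>1\<close>; the value at \<open>0\<close> is the empty graph by convention.
\<close>

fun seq_attachment :: "nat \<Rightarrow> nat pair_pre_digraph pmf" where
  "seq_attachment 0 = return_pmf \<lparr>pverts = {}, parcs = {}\<rparr>"
| "seq_attachment (Suc 0) = return_pmf \<lparr>pverts = {1}, parcs = {}\<rparr>"
| "seq_attachment (Suc (Suc t)) = do {
     G \<leftarrow> seq_attachment (Suc t);
     k \<leftarrow> pmf_of_set {0..Suc t};
     W \<leftarrow> pmf_of_set {W. W \<subseteq> pverts G \<and> card W = k};
     return_pmf (attach_vertex (Suc (Suc t)) W G)
   }"

definition likelihood :: "'a pair_pre_digraph \<Rightarrow> real" where
  "likelihood H = measure_pmf.prob (seq_attachment (card (pverts H)))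
     {G. digraph_iso (with_proj G) (with_proj H)}"

definition complete_bipartite :: "nat \<Rightarrow> nat \<Rightarrow> (nat + nat) pair_pre_digraph" where
  "complete_bipartite a b = (let A = Inl ` {..<a}; B = Inr ` {..<b} in
     \<lparr>pverts = A \<union> B, parcs = A \<times> B \<union> B \<times> A\<rparr>)"

lemma complete_bipartite_correct: "K\<^bsub>a,b\<^esub> (with_proj (complete_bipartite a b))"
  unfolding complete_bipartite_digraph_pair_def complete_bipartite_def Let_def
  by (intro conjI exI[of _ "Inl ` {..<a}"] exI[of _ "Inr ` {..<b}"]) (auto simp: card_image)

lemma pair_graph_complete_bipartite: "pair_graph (complete_bipartite a b)"
  using complete_bipartite_correct by (rule pair_graphI_complete_bipartite)

lemma card_pverts_complete_bipartite: "card (pverts (complete_bipartite a b)) = a + b"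
proof -
  have "Inl ` {..<a} \<inter> Inr ` {..<b} = {}" by auto
  then show ?thesis
    by (simp add: complete_bipartite_def Let_def card_Un_disjoint card_image)
qed

lemma pair_graph_attach_vertex:
  assumes "pair_graph G" "v \<notin> pverts G" "W \<subseteq> pverts G"
  shows "pair_graph (attach_vertex v W G)"
proof -
  interpret pair_graph G by fact
  have fW: "finite W" using assms(3) pair_finite_verts by (rule finite_subset)
  have "sym (parcs G)" using pair_sym_arcs by (simp add: symmetric_def)
  then have "sym (parcs (attach_vertex v W G))"
    by (auto simp: attach_vertex_def sym_def)
  then show ?thesis
    using assms fW pair_finite_verts pair_finite_arcs pair_no_loops
    by unfold_locales
      (auto simp: attach_vertex_def symmetric_def dest: in_arcsD1 in_arcsD2)
qed

lemma seq_attachment_support: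
  "G \<in> set_pmf (seq_attachment n) \<Longrightarrow> pair_graph G \<and> pverts G = {1..n}"
proof (induction n arbitrary: G rule: seq_attachment.induct)
  case (3 t)
  obtain G' k W where G': "G' \<in> set_pmf (seq_attachment (Suc t))"
    and k: "k \<in> set_pmf (pmf_of_set {0..Suc t})"
    and W: "W \<in> set_pmf (pmf_of_set {W. W \<subseteq> pverts G' \<and> card W = k})"
    and G: "G = attach_vertex (Suc (Suc t)) W G'"
    using "3.prems" by auto
  have IH: "pair_graph G'" "pverts G' = {1..Suc t}"
    using "3.IH"[OF G'] by auto
  have "k \<le> card (pverts G')" using k IH by (simp add: set_pmf_of_set)
  then obtain W0 where "W0 \<subseteq> pverts G'" "card W0 = k"
    by (meson obtain_subset_with_card_n)
  then have ne: "{W. W \<subseteq> pverts G' \<and> card W = k} \<noteq> {}" by auto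
  have "finite {W. W \<subseteq> pverts G' \<and> card W = k}" using IH by simp
  then have "W \<subseteq> pverts G'" using W ne by (simp add: set_pmf_of_set)
  then show ?case
    using pair_graph_attach_vertex[of G' "Suc (Suc t)" W] IH
    by (auto simp: G attach_vertex_def)
qed (simp_all, (unfold_locales; auto simp: symmetric_def sym_def)+)

lemma digraph_iso_with_proj_iff:
  assumes "pair_graph G" "pair_graph H"
  shows "digraph_iso (with_proj G) (with_proj H) \<longleftrightarrow>
    (\<exists>f. bij_betw f (pverts G) (pverts H) \<and>
      (\<forall>u\<in>pverts G. \<forall>v\<in>pverts G. (u, v) \<in> parcs G \<longleftrightarrow> (f u, f v) \<in> parcs H))"
proof
  interpret G: pair_graph G by fact
  assume "digraph_iso (with_proj G) (with_proj H)"
  then obtain h where h: "G.digraph_isomorphism h" "with_proj H = app_iso h (with_proj G)"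
    by (auto simp: digraph_iso_def)
  let ?f = "iso_verts h"
  have V: "pverts H = ?f ` pverts G" and A: "parcs H = iso_arcs h ` parcs G"
    and t: "iso_tail h = fst" "iso_head h = snd"
    using h(2) by (auto simp: app_iso_def with_proj_def)
  have arc: "iso_arcs h e = (?f (fst e), ?f (snd e))" if "e \<in> parcs G" for e
    using h(1) that t unfolding G.digraph_isomorphism_def by (auto simp: prod_eq_iff)
  have inj: "inj_on ?f (pverts G)"
    using h(1) unfolding G.digraph_isomorphism_def by auto
  have "(u, v) \<in> parcs G \<longleftrightarrow> (?f u, ?f v) \<in> parcs H"
    if uv: "u \<in> pverts G" "v \<in> pverts G" for u v
  proof
    assume "(u, v) \<in> parcs G"
    then show "(?f u, ?f v) \<in> parcs H" using arc[of "(u, v)"] A by force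
  next
    assume "(?f u, ?f v) \<in> parcs H"
    then obtain x y where xy: "(x, y) \<in> parcs G" "(?f u, ?f v) = iso_arcs h (x, y)"
      using A by auto
    then have "?f u = ?f x" "?f v = ?f y" using arc[of "(x, y)"] by auto
    then have "u = x" "v = y"
      using inj uv G.in_arcsD1[OF xy(1)] G.in_arcsD2[OF xy(1)] by (auto dest: inj_onD)
    then show "(u, v) \<in> parcs G" using xy by simp
  qed
  then show "\<exists>f. bij_betw f (pverts G) (pverts H) \<and>
      (\<forall>u\<in>pverts G. \<forall>v\<in>pverts G. (u, v) \<in> parcs G \<longleftrightarrow> (f u, f v) \<in> parcs H)"
    using inj V by (intro exI[of _ ?f]) (auto simp: bij_betw_def)
next
  interpret G: pair_graph G by fact
  interpret H: pair_graph H by fact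
  assume "\<exists>f. bij_betw f (pverts G) (pverts H) \<and>
      (\<forall>u\<in>pverts G. \<forall>v\<in>pverts G. (u, v) \<in> parcs G \<longleftrightarrow> (f u, f v) \<in> parcs H)"
  then obtain f where f: "bij_betw f (pverts G) (pverts H)"
    and E: "\<And>u v. u \<in> pverts G \<Longrightarrow> v \<in> pverts G \<Longrightarrow> (u, v) \<in> parcs G \<longleftrightarrow> (f u, f v) \<in> parcs H"
    by auto
  let ?h = "\<lparr>iso_verts = f, iso_arcs = map_prod f f, iso_head = snd, iso_tail = fst\<rparr>"
  have inj: "inj_on f (pverts G)" and V: "f ` pverts G = pverts H"
    using f by (auto simp: bij_betw_def)
  have "inj_on (map_prod f f) (parcs G)"
    using map_prod_inj_on[OF inj inj]
    by (rule inj_on_subset) (auto dest: G.in_arcsD1 G.in_arcsD2)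
  then have iso: "G.digraph_isomorphism ?h"
    unfolding G.digraph_isomorphism_def using inj G.wf_digraph_axioms by auto
  have "map_prod f f ` parcs G \<subseteq> parcs H"
    using E by (auto dest: G.in_arcsD1 G.in_arcsD2)
  moreover have "(x, y) \<in> map_prod f f ` parcs G" if xy: "(x, y) \<in> parcs H" for x y
  proof -
    have "x \<in> pverts H" "y \<in> pverts H" using xy by (auto dest: H.in_arcsD1 H.in_arcsD2)
    then obtain u v where "u \<in> pverts G" "v \<in> pverts G" "x = f u" "y = f v"
      unfolding V[symmetric] by blast
    then show ?thesis using E[of u v] xy by force
  qed
  ultimately have "map_prod f f ` parcs G = parcs H" by auto
  then have "with_proj H = app_iso ?h (with_proj G)"
    using V by (simp add: app_iso_def with_proj_def)
  then show "digraph_iso (with_proj G) (with_proj H)"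
    using iso unfolding digraph_iso_def by blast
qed

end

theory Submission
  imports Defs
begin

text \<open>
  A vertex arriving at time \<open>t + 1\<close> has a given set \<open>W\<close> of neighbours with probability
  \<open>1 / ((t + 1) (t choose card W))\<close>. Suppose the labels \<open>1, \<dots>, n\<close> are split into \<open>A\<close> and its
  complement, and \<open>i\<close> of the first \<open>t\<close> labels lie in \<open>A\<close>. In the complete bipartite graph on this split,
  the next vertex has \<open>t - i\<close> earlier neighbours if it lies in \<open>A\<close> and \<open>i\<close> otherwise; as
  \<open>t choose i = t choose (t - i)\<close>, the cost of the step depends only on \<open>i\<close>. So the probability of
  the labelled graph is \<open>1 / n!\<close> times a product of reciprocal binomial coefficients along the lattice
  path that \<open>A\<close> describes, and summing over all \<open>A\<close> of size \<open>a\<close> gives numbers \<open>x\<^sub>n(a) / n!\<close>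
  (\<open>x\<^sub>n(a)\<close> is \<open>path_weight n a\<close>, see \<open>sum_pmf_bipartite_on\<close>) with
  \<open>x\<^sub>n\<^sub>+\<^sub>1(a + 1) = c\<^sub>n(a) + c\<^sub>n(a + 1)\<close>, where \<open>c\<^sub>n(a) = x\<^sub>n(a) / (n choose a)\<close> is \<open>mean_weight n a\<close>.

  For \<open>2a < n\<close> the graph determines \<open>A\<close>, so \<open>x\<^sub>n(a) / n!\<close> is the likelihood. For \<open>2a = n\<close> both parts
  have the same size and every graph is counted twice; keeping only the sets \<open>A\<close> that contain the last
  vertex leaves \<open>c\<^sub>n\<^sub>-\<^sub>1(a - 1) / n!\<close>.

  The heart of the proof is that \<open>c\<^sub>n\<close> strictly decreases on \<open>0, \<dots>, n div 2\<close> for \<open>n \<ge> 3\<close>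
  (\<open>mean_weight_strict_decreasing\<close>): by the recurrence
  \<open>x\<^sub>n\<^sub>+\<^sub>1(a) - x\<^sub>n\<^sub>+\<^sub>1(a + 1) = c\<^sub>n(a - 1) - c\<^sub>n(a + 1)\<close>, which is positive by induction and the symmetry
  \<open>c\<^sub>n(a) = c\<^sub>n(n - a)\<close>, while the binomial coefficient in the denominator grows. Hence the likelihood
  decreases from \<open>a = 1\<close> on. The edgeless graph, with \<open>x\<^sub>n(0) = 1\<close>, escapes this pattern; it is compared
  with the centre directly, through \<open>c\<^sub>n\<^sub>-\<^sub>1(n div 2 - 1) < c\<^sub>n\<^sub>-\<^sub>1(0) = 1\<close> for even \<open>n\<close> and through
  \<open>c\<^sub>n\<^sub>-\<^sub>1(1) < 1 / 2\<close> for odd \<open>n\<close>.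
\<close>

section \<open>Lattice path weights\<close>

text \<open>
  The sum, over all lattice paths with unit steps from the origin to \<open>(a, n - a)\<close>, of the product of
  \<open>1 / ((i + j) choose i)\<close> over the points \<open>(i, j)\<close> visited before the last one. It vanishes for
  \<open>a > n\<close>, and there the recursion is harmless because division by zero yields zero.
\<close>

fun path_weight :: "nat \<Rightarrow> nat \<Rightarrow> real" where
  "path_weight 0 a = (if a = 0 then 1 else 0)"
| "path_weight (Suc n) 0 = path_weight n 0 / real (n choose 0)"
| "path_weight (Suc n) (Suc a) =
     path_weight n a / real (n choose a) + path_weight n (Suc a) / real (n choose Suc a)"

text \<open>
  Up to the factor \<open>n!\<close>, this is the mean probability of the labelled complete bipartite graphs with
  one part running over the \<open>a\<close>-subsets of the \<open>n\<close> labels. By the recursion above, consecutive values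
  add up to a path weight one level higher.
\<close>

definition mean_weight :: "nat \<Rightarrow> nat \<Rightarrow> real" where
  "mean_weight n a = path_weight n a / real (n choose a)"

lemma path_weight_Suc_Suc:
  "path_weight (Suc n) (Suc a) = mean_weight n a + mean_weight n (Suc a)"
  by (simp add: mean_weight_def)

lemma path_weight_0_right [simp]: "path_weight n 0 = 1"
  by (induction n) auto

lemma mean_weight_0_right [simp]: "mean_weight n 0 = 1"
  by (simp add: mean_weight_def)

lemma path_weight_eq_0: "n < a \<Longrightarrow> path_weight n a = 0"
proof (induction n arbitrary: a)
  case (Suc n)
  then show ?case by (cases a) auto
qed auto

lemma path_weight_diag: "path_weight n n = 1"
  by (induction n) (simp_all add: path_weight_eq_0)

lemma path_weight_pos: "a \<le> n \<Longrightarrow> 0 < path_weight n a"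
proof (induction n arbitrary: a)
  case (Suc n)
  show ?case
  proof (cases a)
    case (Suc a')
    then have "0 < path_weight n a' / real (n choose a')"
      using Suc.IH[of a'] Suc.prems by simp
    moreover have "0 \<le> path_weight n (Suc a') / real (n choose Suc a')"
      using Suc.IH[of "Suc a'"] path_weight_eq_0[of n "Suc a'"]
      by (cases "Suc a' \<le> n") auto
    ultimately show ?thesis using Suc by simp
  qed simp
qed auto

lemma mean_weight_pos: "a \<le> n \<Longrightarrow> 0 < mean_weight n a"
  by (simp add: mean_weight_def path_weight_pos)

lemma path_weight_sym: "a + b = n \<Longrightarrow> path_weight n a = path_weight n b"
proof (induction n arbitrary: a b)
  case (Suc n)
  show ?case
  proof (cases "a = 0 \<or> b = 0")
    case True
    then show ?thesis using Suc.prems path_weight_diag[of "Suc n"] by auto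
  next
    case False
    then obtain a' b' where ab: "a = Suc a'" "b = Suc b'"
      by (metis not0_implies_Suc)
    have "path_weight n a' = path_weight n (Suc b')" "path_weight n (Suc a') = path_weight n b'"
      using Suc.IH[of a' "Suc b'"] Suc.IH[of "Suc a'" b'] Suc.prems ab by auto
    moreover have "n choose a' = n choose Suc b'" "n choose Suc a' = n choose b'"
      using binomial_symmetric[of a' n] binomial_symmetric[of b' n] Suc.prems ab by auto
    ultimately show ?thesis by (simp add: ab)
  qed
qed simp

lemma mean_weight_sym: "a + b = n \<Longrightarrow> mean_weight n a = mean_weight n b"
  using path_weight_sym[of a b n] binomial_symmetric[of a n] by (auto simp: mean_weight_def)

text \<open>
  The induction starts at \<open>n = 3\<close> because \<open>mean_weight 2 1 = 1 = mean_weight 2 0\<close>. In the step to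
  row \<open>n + 1\<close>, the binomial denominator does not decrease. The numerators for \<open>a > 0\<close> and \<open>a + 1\<close> share a
  summand, so only \<open>mean_weight n (a - 1)\<close> and \<open>mean_weight n (a + 1)\<close> have to be compared. For
  \<open>a = 0\<close> the numerator grows, but stays below \<open>2\<close>.
\<close>

lemma mean_weight_Suc_less:
  assumes "3 \<le> n" "2 * Suc a \<le> n"
  shows "mean_weight n (Suc a) < mean_weight n a"
  using assms
proof (induction n arbitrary: a rule: dec_induct)
  case base
  then have "a = 0" by simp
  then show ?case by (simp add: mean_weight_def numeral_3_eq_3)
next
  case (step n)
  show ?case
  proof (cases a)
    case 0
    have "mean_weight n 1 < 1" using step.IH[of 0] step.hyps by simp
    then have "path_weight (Suc n) 1 < 2"
      using path_weight_Suc_Suc[of n 0] by simp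
    then show ?thesis using 0 step.hyps by (simp add: mean_weight_def divide_simps del: path_weight.simps)
  next
    case (Suc b)
    have b: "mean_weight n (Suc b) < mean_weight n b"
      using step.IH[of b] step.prems Suc by simp
    have "mean_weight n (Suc (Suc b)) \<le> mean_weight n (Suc b)"
      \<comment> \<open>The index may lie just beyond the middle of row \<open>n\<close>, where symmetry reflects it back.\<close>
    proof (cases "2 * Suc (Suc b) \<le> n")
      case True
      then show ?thesis using step.IH[of "Suc b"] by simp
    next
      case False
      then have "Suc b + Suc (Suc b) = n" using step.prems Suc by simp
      then show ?thesis using mean_weight_sym[of "Suc b" "Suc (Suc b)" n] by simp
    qed
    with b have "path_weight (Suc n) (Suc a) < path_weight (Suc n) a"
      by (simp add: Suc path_weight_Suc_Suc del: path_weight.simps)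
    moreover have "Suc n choose a \<le> Suc n choose Suc a"
      using step.prems by (intro binomial_mono) auto
    moreover have "0 < Suc n choose a" using step.prems by simp
    moreover have "0 < path_weight (Suc n) (Suc a)"
      using step.prems by (intro path_weight_pos) auto
    ultimately show ?thesis
      unfolding mean_weight_def by (intro frac_less) auto
  qed
qed

lemma mean_weight_strict_decreasing:
  assumes "3 \<le> n" "a < b" "2 * b \<le> n"
  shows "mean_weight n b < mean_weight n a"
  using assms(2,3)
proof (induction b)
  case (Suc b)
  then show ?case
    using mean_weight_Suc_less[of n b] assms(1) by (cases "a = b") auto
qed auto

lemma mean_weight_1_less:
  assumes "4 \<le> n"
  shows "mean_weight n 1 < 1 / 2"
proof -
  obtain m where m: "n = Suc m" "3 \<le> m" using assms by (cases n) auto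
  have "mean_weight m 1 < 1" using mean_weight_Suc_less[of m 0] m by simp
  then have "path_weight n 1 < 2" using path_weight_Suc_Suc[of m 0] m by simp
  then show ?thesis using assms by (simp add: mean_weight_def divide_simps del: path_weight.simps)
qed

text \<open>
  Strict although the mean weights are only compared weakly when \<open>a = h\<close>: for \<open>a > 0\<close> the path weight
  has a second, positive summand, and for \<open>a = 0\<close> it equals \<open>mean_weight (2 * h + 1) 0\<close>.
\<close>

lemma mean_weight_less_path_weight:
  assumes "1 \<le> h" "a \<le> h"
  shows "mean_weight (2 * h + 1) h < path_weight (Suc (2 * h + 1)) a"
proof (cases a)
  case 0
  have "mean_weight (2 * h + 1) h < mean_weight (2 * h + 1) 0"
    using assms by (intro mean_weight_strict_decreasing) auto
  then show ?thesis using 0 by (simp del: path_weight.simps)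
next
  case (Suc b)
  have "mean_weight (2 * h + 1) h \<le> mean_weight (2 * h + 1) (Suc b)"
    using mean_weight_strict_decreasing[of "2 * h + 1" "Suc b" h] assms Suc
    by (cases "Suc b = h") auto
  moreover have "0 < mean_weight (2 * h + 1) b"
    using assms Suc by (intro mean_weight_pos) simp
  ultimately show ?thesis unfolding Suc path_weight_Suc_Suc by linarith
qed

text \<open>
  For \<open>a > 0\<close> both summands of the path weight decrease towards the centre. For \<open>a = 0\<close> the path
  weight is only \<open>1\<close>, but both summands at the centre lie below \<open>1 / 2\<close>; for this \<open>h \<ge> 2\<close> is needed, as
  the two centre summands for \<open>h = 1\<close> add up to \<open>2\<close>.
\<close>

lemma path_weight_centre_less:
  assumes "2 \<le> h" "a < h"
  shows "path_weight (Suc (2 * h)) h < path_weight (Suc (2 * h)) a"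
proof -
  obtain g where g: "h = Suc g" "1 \<le> g" using assms by (cases h) auto
  have centre: "path_weight (Suc (2 * h)) h = mean_weight (2 * h) g + mean_weight (2 * h) h"
    using path_weight_Suc_Suc[of "2 * h" g] g(1) by simp
  show ?thesis
  proof (cases a)
    case 0
    have dec: "mean_weight (2 * h) b \<le> mean_weight (2 * h) 1" if "1 \<le> b" "b \<le> h" for b
      using mean_weight_strict_decreasing[of "2 * h" 1 b] that assms by (cases "b = 1") auto
    have "mean_weight (2 * h) 1 < 1 / 2" using mean_weight_1_less[of "2 * h"] assms by simp
    moreover have "mean_weight (2 * h) g \<le> mean_weight (2 * h) 1"
      using g by (intro dec) auto
    moreover have "mean_weight (2 * h) h \<le> mean_weight (2 * h) 1"
      using assms by (intro dec) auto
    ultimately show ?thesis unfolding centre 0 path_weight_0_right by linarith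
  next
    case (Suc b)
    have "mean_weight (2 * h) g < mean_weight (2 * h) b"
      using g assms Suc by (intro mean_weight_strict_decreasing) auto
    moreover have "mean_weight (2 * h) h < mean_weight (2 * h) (Suc b)"
      using g assms Suc by (intro mean_weight_strict_decreasing) auto
    ultimately show ?thesis unfolding centre Suc path_weight_Suc_Suc by linarith
  qed
qed

section \<open>The probability of a labelled graph\<close>

text \<open>
  The neighbourhood of the new vertex and the graph induced on the old ones can be read off, so a
  labelled graph has just one history.
\<close>

lemma attach_vertex_inject:
  assumes "pair_graph G" "pair_graph G'" "pverts G = pverts G'" "v \<notin> pverts G"
    "W \<subseteq> pverts G" "W' \<subseteq> pverts G"
  shows "attach_vertex v W G = attach_vertex v W' G' \<longleftrightarrow> W = W' \<and> G = G'"
proof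
  interpret G: pair_graph G by fact
  interpret G': pair_graph G' by fact
  assume eq: "attach_vertex v W G = attach_vertex v W' G'"
  have arcs: "parcs G \<subseteq> pverts G \<times> pverts G" "parcs G' \<subseteq> pverts G \<times> pverts G"
    using G.in_arcsD1 G.in_arcsD2 G'.in_arcsD1 G'.in_arcsD2 assms(3) by auto
  have e: "parcs G \<union> {v} \<times> W \<union> W \<times> {v} = parcs G' \<union> {v} \<times> W' \<union> W' \<times> {v}"
    using eq by (simp add: attach_vertex_def)
  have "W = {w. (v, w) \<in> parcs G \<union> {v} \<times> W \<union> W \<times> {v}}" using arcs assms by blast
  also have "\<dots> = W'" unfolding e using arcs assms by blast
  finally have W: "W = W'" .
  have "parcs G = (parcs G \<union> {v} \<times> W \<union> W \<times> {v}) \<inter> pverts G \<times> pverts G"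
    using arcs assms by blast
  also have "\<dots> = parcs G'" unfolding e using arcs assms by blast
  finally show "W = W' \<and> G = G'" using W assms(3) by simp
qed auto

text \<open>
  There is one choice of earlier graph, degree and neighbourhood that leads to the given graph, so the
  probability is a single product rather than a sum.
\<close>

lemma pmf_seq_attachment_attach_vertex:
  assumes G: "pair_graph G" "pverts G = {1..t}" and W: "W \<subseteq> {1..t}"
  shows "pmf (seq_attachment (Suc t)) (attach_vertex (Suc t) W G) =
    pmf (seq_attachment t) G / (real (Suc t) * real (t choose card W))"
proof (cases t)
  case 0
  interpret pair_graph G by fact
  have "parcs G = {}" using in_arcsD1 G(2) 0 by fastforce
  then have "G = \<lparr>pverts = {}, parcs = {}\<rparr>" using G(2) 0 by simp
  then show ?thesis using W 0 by (simp add: attach_vertex_def)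
next
  case (Suc s)
  let ?S = "\<lambda>k. {W. W \<subseteq> {1..t} \<and> card W = k}"
  let ?H = "attach_vertex (Suc t) W G"
  let ?c = "1 / (real (Suc t) * real (t choose card W))"
  let ?step = "\<lambda>G'. do {
     k \<leftarrow> pmf_of_set {0..t};
     W' \<leftarrow> pmf_of_set {W. W \<subseteq> pverts G' \<and> card W = k};
     return_pmf (attach_vertex (Suc t) W' G')}"
  have cardW: "card W \<le> t" using card_mono[OF _ W] by simp
  have step: "pmf (?step G') ?H = indicator {G} G' * ?c" if "G' \<in> set_pmf (seq_attachment t)" for G'
  proof -
    have G': "pair_graph G'" "pverts G' = {1..t}" using seq_attachment_support[OF that] by auto
    have inner: "pmf (pmf_of_set (?S k) \<bind> (\<lambda>W'. return_pmf (attach_vertex (Suc t) W' G'))) ?H =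
        (if k = card W then indicator {G} G' / real (t choose card W) else 0)"
      if k: "k \<in> {0..t}" for k
    proof -
      obtain W0 where "W0 \<subseteq> {1..t}" "card W0 = k"
        using obtain_subset_with_card_n[of k "{1..t}"] k by auto
      then have ne: "?S k \<noteq> {}" by auto
      have "pmf (pmf_of_set (?S k) \<bind> (\<lambda>W'. return_pmf (attach_vertex (Suc t) W' G'))) ?H =
        (\<Sum>W'\<in>?S k. pmf (return_pmf (attach_vertex (Suc t) W' G')) ?H) / card (?S k)"
        using ne by (intro pmf_bind_pmf_of_set) auto
      also have "(\<Sum>W'\<in>?S k. pmf (return_pmf (attach_vertex (Suc t) W' G')) ?H) =
        (\<Sum>W'\<in>?S k. if W' = W then indicator {G} G' else 0)"
        using attach_vertex_inject[OF G'(1) G(1)] G G' W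
        by (intro sum.cong) (auto simp: indicator_def)
      also have "\<dots> = (if k = card W then indicator {G} G' else 0)"
        using W by (simp add: sum.delta)
      also have "card (?S k) = t choose k" using n_subsets[of "{1..t}" k] by simp
      finally show ?thesis by simp
    qed
    have "pmf (?step G') ?H = (\<Sum>k\<in>{0..t}. pmf (pmf_of_set (?S k) \<bind>
        (\<lambda>W'. return_pmf (attach_vertex (Suc t) W' G'))) ?H) / card {0..t}"
      unfolding G'(2) by (intro pmf_bind_pmf_of_set) auto
    also have "\<dots> = (\<Sum>k\<in>{0..t}. if k = card W then indicator {G} G' / real (t choose card W) else 0)
        / card {0..t}"
      by (intro arg_cong2[where f = "(/)"] sum.cong refl inner)
    also have "\<dots> = indicator {G} G' * ?c" using cardW by (simp add: sum.delta)
    finally show ?thesis .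
  qed
  have "pmf (seq_attachment (Suc t)) ?H = (\<integral>G'. pmf (?step G') ?H \<partial>seq_attachment t)"
    unfolding Suc seq_attachment.simps by (rule pmf_bind)
  also have "\<dots> = (\<integral>G'. indicator {G} G' * ?c \<partial>seq_attachment t)"
    using step by (intro integral_cong_AE) (auto simp: AE_measure_pmf_iff)
  also have "\<dots> = pmf (seq_attachment t) G * ?c"
    by (simp add: measure_pmf_single)
  finally show ?thesis by simp
qed

section \<open>Labelled complete bipartite graphs\<close>

definition bipartite_on :: "nat \<Rightarrow> nat set \<Rightarrow> nat pair_pre_digraph" where
  "bipartite_on n A =
     \<lparr>pverts = {1..n}, parcs = A \<times> ({1..n} - A) \<union> ({1..n} - A) \<times> A\<rparr>"

abbreviation subsets_of_card :: "nat \<Rightarrow> nat \<Rightarrow> nat set set" where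
  "subsets_of_card n a \<equiv> {A. A \<subseteq> {1..n} \<and> card A = a}"

lemma pair_graph_bipartite_on:
  assumes "A \<subseteq> {1..n}"
  shows "pair_graph (bipartite_on n A)"
proof -
  have "finite A" using assms finite_subset by blast
  then show ?thesis using assms
    by unfold_locales (auto simp: bipartite_on_def symmetric_def sym_def)
qed

lemma bipartite_on_Suc:
  assumes "A \<subseteq> {1..n}"
  shows "bipartite_on (Suc n) A = attach_vertex (Suc n) A (bipartite_on n A)"
    and "bipartite_on (Suc n) (insert (Suc n) A) =
      attach_vertex (Suc n) ({1..n} - A) (bipartite_on n A)"
proof -
  have "{1..Suc n} = insert (Suc n) {1..n}" by auto
  moreover have "Suc n \<notin> A" using assms by auto
  ultimately show "bipartite_on (Suc n) A = attach_vertex (Suc n) A (bipartite_on n A)"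
    and "bipartite_on (Suc n) (insert (Suc n) A) =
      attach_vertex (Suc n) ({1..n} - A) (bipartite_on n A)"
    using assms by (auto simp: bipartite_on_def attach_vertex_def)
qed

text \<open>
  The new vertex costs the same whichever part it joins: its back-degree is \<open>card A\<close> or
  \<open>n - card A\<close>, and these have equal binomial coefficients.
\<close>

lemma pmf_bipartite_on_Suc:
  assumes A: "A \<subseteq> {1..n}"
  shows "pmf (seq_attachment (Suc n)) (bipartite_on (Suc n) A) =
      pmf (seq_attachment n) (bipartite_on n A) / (real (Suc n) * real (n choose card A))"
    and "pmf (seq_attachment (Suc n)) (bipartite_on (Suc n) (insert (Suc n) A)) =
      pmf (seq_attachment n) (bipartite_on n A) / (real (Suc n) * real (n choose card A))"
proof -
  have V: "pverts (bipartite_on n A) = {1..n}" by (simp add: bipartite_on_def)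
  note G = pair_graph_bipartite_on[OF A] V
  have fin: "finite A" and le: "card A \<le> n"
    using A finite_subset card_mono[OF _ A] by auto
  have "card ({1..n} - A) = n - card A" using A fin by (simp add: card_Diff_subset)
  then have "n choose card ({1..n} - A) = n choose card A"
    using binomial_symmetric[OF le] by simp
  then show "pmf (seq_attachment (Suc n)) (bipartite_on (Suc n) A) =
      pmf (seq_attachment n) (bipartite_on n A) / (real (Suc n) * real (n choose card A))"
    and "pmf (seq_attachment (Suc n)) (bipartite_on (Suc n) (insert (Suc n) A)) =
      pmf (seq_attachment n) (bipartite_on n A) / (real (Suc n) * real (n choose card A))"
    using pmf_seq_attachment_attach_vertex[OF G A]
      pmf_seq_attachment_attach_vertex[OF G, of "{1..n} - A"]
    by (simp_all only: bipartite_on_Suc[OF A]) auto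
qed

lemma subsets_of_card_Suc_with:
  "{A \<in> subsets_of_card (Suc n) (Suc a). Suc n \<in> A} = insert (Suc n) ` subsets_of_card n a"
proof (intro equalityI subsetI)
  fix A assume A: "A \<in> {A \<in> subsets_of_card (Suc n) (Suc a). Suc n \<in> A}"
  then have "A = insert (Suc n) (A - {Suc n})" by auto
  moreover have "A - {Suc n} \<subseteq> {1..n}"
  proof
    fix x assume x: "x \<in> A - {Suc n}"
    then have "x \<in> {1..Suc n}" "x \<noteq> Suc n" using A by auto
    then show "x \<in> {1..n}" by auto
  qed
  moreover have "finite A" using A finite_subset by blast
  then have "card (A - {Suc n}) = a" using A by auto
  ultimately show "A \<in> insert (Suc n) ` subsets_of_card n a" by blast
next
  fix A assume "A \<in> insert (Suc n) ` subsets_of_card n a"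
  then obtain B where B: "B \<subseteq> {1..n}" "card B = a" "A = insert (Suc n) B" by auto
  then have "finite B" "Suc n \<notin> B" using finite_subset by auto
  then show "A \<in> {A \<in> subsets_of_card (Suc n) (Suc a). Suc n \<in> A}" using B by auto
qed

lemma subsets_of_card_Suc_without:
  "{A \<in> subsets_of_card (Suc n) a. Suc n \<notin> A} = subsets_of_card n a"
proof -
  have "A \<subseteq> {1..Suc n} \<and> Suc n \<notin> A \<longleftrightarrow> A \<subseteq> {1..n}" for A :: "nat set"
    by (force simp: subset_iff le_Suc_eq)
  then show ?thesis by blast
qed

lemma sum_pmf_bipartite_on_without:
  "(\<Sum>A\<in>{A \<in> subsets_of_card (Suc n) a. Suc n \<notin> A}. pmf (seq_attachment (Suc n)) (bipartite_on (Suc n) A)) =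
   (\<Sum>A\<in>subsets_of_card n a. pmf (seq_attachment n) (bipartite_on n A)) / (real (Suc n) * real (n choose a))"
  unfolding subsets_of_card_Suc_without sum_divide_distrib
  by (intro sum.cong) (auto simp: pmf_bipartite_on_Suc simp del: seq_attachment.simps)

lemma sum_pmf_bipartite_on_with:
  "(\<Sum>A\<in>{A \<in> subsets_of_card (Suc n) (Suc a). Suc n \<in> A}. pmf (seq_attachment (Suc n)) (bipartite_on (Suc n) A)) =
   (\<Sum>A\<in>subsets_of_card n a. pmf (seq_attachment n) (bipartite_on n A)) / (real (Suc n) * real (n choose a))"
proof -
  have "inj_on (insert (Suc n)) (subsets_of_card n a)"
  proof (rule inj_onI)
    fix A B assume "A \<in> subsets_of_card n a" "B \<in> subsets_of_card n a"
      and eq: "insert (Suc n) A = insert (Suc n) B"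
    then have "Suc n \<notin> A" "Suc n \<notin> B" by auto
    then show "A = B" using eq by (simp add: insert_ident)
  qed
  then show ?thesis
    unfolding subsets_of_card_Suc_with sum_divide_distrib
    by (subst sum.reindex) (auto intro!: sum.cong simp: pmf_bipartite_on_Suc simp del: seq_attachment.simps)
qed

text \<open>
  Splitting the sets according to the part that contains the last vertex gives the recursion of the
  path weights.
\<close>

lemma sum_pmf_bipartite_on:
  "(\<Sum>A\<in>subsets_of_card n a. pmf (seq_attachment n) (bipartite_on n A)) = path_weight n a / fact n"
proof (induction n arbitrary: a)
  case 0
  have "subsets_of_card 0 a = (if a = 0 then {{}} else {})" by auto
  then show ?case by (simp add: bipartite_on_def)
next
  case (Suc n)
  let ?p = "\<lambda>A. pmf (seq_attachment (Suc n)) (bipartite_on (Suc n) A)"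
  have split: "sum ?p (subsets_of_card (Suc n) c) =
      sum ?p {A \<in> subsets_of_card (Suc n) c. Suc n \<in> A} +
      sum ?p {A \<in> subsets_of_card (Suc n) c. Suc n \<notin> A}" for c
    by (subst sum.union_disjoint[symmetric]) (auto intro!: sum.cong)
  show ?case
  proof (cases a)
    case 0
    have "{A \<in> subsets_of_card (Suc n) 0. Suc n \<in> A} = {}"
      using finite_subset[of _ "{1..Suc n}"] by auto
    then have w: "sum ?p {A \<in> subsets_of_card (Suc n) 0. Suc n \<in> A} = 0" by (simp only: sum.empty)
    show ?thesis
      unfolding 0 split w sum_pmf_bipartite_on_without Suc.IH by simp
  next
    case (Suc b)
    show ?thesis
      unfolding Suc split sum_pmf_bipartite_on_without sum_pmf_bipartite_on_with Suc.IH
      by (simp add: add_divide_distrib mult_ac)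
  qed
qed

text \<open>
  The vertices not adjacent to a vertex \<open>u\<close> of \<open>A\<close> are those in its own part: this is \<open>A\<close>, and it is
  also \<open>B\<close> or the complement of \<open>B\<close>, whichever contains \<open>u\<close>.
\<close>

lemma bipartite_on_eqD:
  assumes "bipartite_on n A = bipartite_on n B" "A \<subseteq> {1..n}" "B \<subseteq> {1..n}" "A \<noteq> {}"
  shows "B = A \<or> B = {1..n} - A"
proof -
  obtain u where u: "u \<in> A" using assms by auto
  have arcs: "A \<times> ({1..n} - A) \<union> ({1..n} - A) \<times> A = B \<times> ({1..n} - B) \<union> ({1..n} - B) \<times> B"
    using assms(1) by (simp add: bipartite_on_def)
  have "{1..n} - A = {v. (u, v) \<in> A \<times> ({1..n} - A) \<union> ({1..n} - A) \<times> A}" using u by auto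
  also have "\<dots> = (if u \<in> B then {1..n} - B else B)"
    unfolding arcs using u assms by auto
  finally show ?thesis using assms by (auto split: if_splits)
qed

text \<open>
  From left to right, \<open>A\<close> is the preimage of the left part; from right to left, bijections between
  the parts are glued together.
\<close>

lemma digraph_iso_complete_bipartite_iff:
  assumes G: "pair_graph G" "pverts G = {1..a + b}"
  shows "digraph_iso (with_proj G) (with_proj (complete_bipartite a b)) \<longleftrightarrow>
    G \<in> bipartite_on (a + b) ` subsets_of_card (a + b) a"
proof -
  interpret G: pair_graph G by fact
  let ?K = "complete_bipartite a b" and ?V = "{1..a + b}"
  have KV: "pverts ?K = Inl ` {..<a} \<union> Inr ` {..<b}"
    and KA: "parcs ?K = Inl ` {..<a} \<times> Inr ` {..<b} \<union> Inr ` {..<b} \<times> Inl ` {..<a}"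
    by (simp_all add: complete_bipartite_def Let_def)
  have "(\<exists>f. bij_betw f ?V (pverts ?K) \<and>
      (\<forall>u\<in>?V. \<forall>v\<in>?V. (u, v) \<in> parcs G \<longleftrightarrow> (f u, f v) \<in> parcs ?K)) \<longleftrightarrow>
    G \<in> bipartite_on (a + b) ` subsets_of_card (a + b) a"
  proof
    assume "\<exists>f. bij_betw f ?V (pverts ?K) \<and>
      (\<forall>u\<in>?V. \<forall>v\<in>?V. (u, v) \<in> parcs G \<longleftrightarrow> (f u, f v) \<in> parcs ?K)"
    then obtain f where f: "bij_betw f ?V (pverts ?K)"
      and arcs: "\<And>u v. u \<in> ?V \<Longrightarrow> v \<in> ?V \<Longrightarrow> (u, v) \<in> parcs G \<longleftrightarrow> (f u, f v) \<in> parcs ?K"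
      by auto
    define A where "A = {u \<in> ?V. f u \<in> Inl ` {..<a}}"
    have "f ` ?V = Inl ` {..<a} \<union> Inr ` {..<b}"
      using f unfolding KV bij_betw_def by blast
    moreover have "f ` A = f ` ?V \<inter> Inl ` {..<a}" unfolding A_def by blast
    ultimately have "f ` A = Inl ` {..<a}" by auto
    moreover have "inj_on f A"
      using f unfolding A_def bij_betw_def by (auto intro: inj_on_subset)
    ultimately have "card A = a"
      by (metis card_image card_lessThan inj_Inl)
    moreover have notA: "f u \<in> Inr ` {..<b} \<longleftrightarrow> u \<notin> A" if "u \<in> ?V" for u
      using bij_betwE[OF f] that unfolding KV A_def by auto
    have "parcs G = A \<times> (?V - A) \<union> (?V - A) \<times> A"
    proof -
      have "(u, v) \<in> parcs G \<longleftrightarrow> (u, v) \<in> A \<times> (?V - A) \<union> (?V - A) \<times> A"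
        if uv: "u \<in> ?V" "v \<in> ?V" for u v
      proof -
        have "(u, v) \<in> parcs G \<longleftrightarrow> u \<in> A \<and> v \<notin> A \<or> u \<notin> A \<and> v \<in> A"
          unfolding arcs[OF uv] KA using notA uv by (auto simp: A_def)
        then show ?thesis using uv by auto
      qed
      moreover have "parcs G \<subseteq> ?V \<times> ?V"
        using G.in_arcsD1 G.in_arcsD2 G(2) by auto
      moreover have "A \<subseteq> ?V" by (auto simp: A_def)
      ultimately show ?thesis by blast
    qed
    then have "G = bipartite_on (a + b) A" using G(2) by (simp add: bipartite_on_def)
    ultimately show "G \<in> bipartite_on (a + b) ` subsets_of_card (a + b) a"
      by (auto simp: A_def)
  next
    assume "G \<in> bipartite_on (a + b) ` subsets_of_card (a + b) a"
    then obtain A where A: "A \<subseteq> ?V" "card A = a" and GA: "G = bipartite_on (a + b) A" by auto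
    have fin: "finite A" using A finite_subset by blast
    then have "card (?V - A) = b" using A by (simp add: card_Diff_subset)
    then obtain g h where g: "bij_betw g A {..<a}" and h: "bij_betw h (?V - A) {..<b}"
      using A fin by (metis bij_betw_iff_card card_lessThan finite_Diff finite_atLeastAtMost finite_lessThan)
    define f :: "nat \<Rightarrow> nat + nat" where "f u = (if u \<in> A then Inl (g u) else Inr (h u))" for u
    have "bij_betw (\<lambda>u. Inl (g u)) A (Inl ` {..<a})"
      using bij_betw_trans[OF g, of Inl "Inl ` {..<a}"] by (simp add: inj_on_imp_bij_betw comp_def)
    then have "bij_betw f A (Inl ` {..<a})"
      by (simp add: f_def cong: bij_betw_cong)
    moreover have "bij_betw (\<lambda>u. Inr (h u)) (?V - A) (Inr ` {..<b})"
      using bij_betw_trans[OF h, of Inr "Inr ` {..<b}"] by (simp add: inj_on_imp_bij_betw comp_def)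
    then have "bij_betw f (?V - A) (Inr ` {..<b})"
      by (rule bij_betw_cong[THEN iffD1, rotated]) (simp add: f_def)
    ultimately have "bij_betw f (A \<union> (?V - A)) (pverts ?K)"
      unfolding KV by (rule bij_betw_combine) auto
    then have "bij_betw f ?V (pverts ?K)" using A by (simp add: Un_absorb1)
    moreover have "(u, v) \<in> parcs G \<longleftrightarrow> (f u, f v) \<in> parcs ?K" if "u \<in> ?V" "v \<in> ?V" for u v
      using that bij_betwE[OF g] bij_betwE[OF h]
      by (auto simp: GA bipartite_on_def KA f_def)
    ultimately show "\<exists>f. bij_betw f ?V (pverts ?K) \<and>
      (\<forall>u\<in>?V. \<forall>v\<in>?V. (u, v) \<in> parcs G \<longleftrightarrow> (f u, f v) \<in> parcs ?K)" by blast
  qed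
  then show ?thesis
    using digraph_iso_with_proj_iff[OF G(1) pair_graph_complete_bipartite] G(2) by simp
qed

section \<open>The likelihood of complete bipartite graphs\<close>

lemma likelihood_complete_bipartite_eq_sum:
  "likelihood (complete_bipartite a b) =
    (\<Sum>G\<in>bipartite_on (a + b) ` subsets_of_card (a + b) a. pmf (seq_attachment (a + b)) G)"
proof -
  let ?M = "seq_attachment (a + b)"
  let ?S = "{G. digraph_iso (with_proj G) (with_proj (complete_bipartite a b))}"
  let ?F = "bipartite_on (a + b) ` subsets_of_card (a + b) a"
  have "?S \<inter> set_pmf ?M = ?F \<inter> set_pmf ?M"
  proof -
    have "G \<in> ?S \<longleftrightarrow> G \<in> ?F" if "G \<in> set_pmf ?M" for G
      unfolding mem_Collect_eq
      using seq_attachment_support[OF that] by (intro digraph_iso_complete_bipartite_iff) auto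
    then show ?thesis by blast
  qed
  then have "measure_pmf.prob ?M (?S \<inter> set_pmf ?M) = measure_pmf.prob ?M (?F \<inter> set_pmf ?M)"
    by (rule arg_cong)
  then have "measure_pmf.prob ?M ?S = measure_pmf.prob ?M ?F"
    by (simp only: measure_Int_set_pmf)
  also have "\<dots> = sum (pmf ?M) ?F" by (intro measure_measure_pmf_finite) simp
  finally show ?thesis by (simp add: likelihood_def card_pverts_complete_bipartite)
qed

text \<open>
  Parts of different sizes cannot be exchanged, so the labelled graph determines \<open>A\<close> and the sum over
  graphs is a sum over sets.
\<close>

lemma likelihood_complete_bipartite:
  assumes "a < b"
  shows "likelihood (complete_bipartite a b) = path_weight (a + b) a / fact (a + b)"
proof -
  have "inj_on (bipartite_on (a + b)) (subsets_of_card (a + b) a)"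
  proof (rule inj_onI)
    fix A B assume A: "A \<in> subsets_of_card (a + b) a" and B: "B \<in> subsets_of_card (a + b) a"
      and eq: "bipartite_on (a + b) A = bipartite_on (a + b) B"
    have fin: "finite A" "finite B" using A B finite_subset by auto
    show "A = B"
    proof (cases "A = {}")
      case True
      then show ?thesis using A B fin by auto
    next
      case False
      have "card ({1..a + b} - A) = b" using A fin by (simp add: card_Diff_subset)
      then have "B \<noteq> {1..a + b} - A" using B assms by auto
      then show ?thesis using bipartite_on_eqD[OF eq] A B False by auto
    qed
  qed
  then show ?thesis
    unfolding likelihood_complete_bipartite_eq_sum
    by (simp only: sum.reindex comp_def sum_pmf_bipartite_on)
qed

text \<open>
  Exactly one part contains the last vertex, so each labelled graph is represented once by a
  set \<open>A\<close> with \<open>Suc n \<in> A\<close>. This accounts for the symmetry without halving, and the result is a single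
  summand of \<open>path_weight (Suc n) (Suc a)\<close>.
\<close>

lemma likelihood_complete_bipartite_balanced:
  assumes n: "Suc n = 2 * Suc a"
  shows "likelihood (complete_bipartite (Suc a) (Suc a)) = mean_weight n a / fact (Suc n)"
proof -
  let ?S = "subsets_of_card (Suc n) (Suc a)"
  let ?T = "{A \<in> ?S. Suc n \<in> A}"
  let ?V = "{1..Suc n}"
  have compl: "bipartite_on (Suc n) A = bipartite_on (Suc n) (?V - A)" if "A \<subseteq> ?V" for A
  proof -
    have "?V - (?V - A) = A" using that by blast
    then show ?thesis by (simp add: bipartite_on_def Un_commute)
  qed
  have "bipartite_on (Suc n) ` ?S = bipartite_on (Suc n) ` ?T"
  proof (intro equalityI subsetI)
    fix G assume "G \<in> bipartite_on (Suc n) ` ?S"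
    then obtain A where A: "A \<subseteq> ?V" "card A = Suc a" "G = bipartite_on (Suc n) A" by auto
    show "G \<in> bipartite_on (Suc n) ` ?T"
    proof (cases "Suc n \<in> A")
      case False
      have "finite A" using A finite_subset by blast
      then have "card (?V - A) = Suc a" using A n by (simp add: card_Diff_subset)
      then have "?V - A \<in> ?T" using False by auto
      then show ?thesis using compl[OF A(1)] A(3) by blast
    qed (use A in auto)
  qed auto
  moreover have "inj_on (bipartite_on (Suc n)) ?T"
  proof (rule inj_onI)
    fix A B assume "A \<in> ?T" "B \<in> ?T" "bipartite_on (Suc n) A = bipartite_on (Suc n) B"
    then show "A = B" using bipartite_on_eqD[of "Suc n" A B] by auto
  qed
  moreover have "Suc a + Suc a = Suc n" using n by simp
  then have "likelihood (complete_bipartite (Suc a) (Suc a)) =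
      (\<Sum>G\<in>bipartite_on (Suc n) ` ?S. pmf (seq_attachment (Suc n)) G)"
    by (simp only: likelihood_complete_bipartite_eq_sum)
  ultimately have "likelihood (complete_bipartite (Suc a) (Suc a)) =
      (\<Sum>A\<in>?T. pmf (seq_attachment (Suc n)) (bipartite_on (Suc n) A))"
    by (simp only: sum.reindex comp_def)
  also have "\<dots> = mean_weight n a / fact (Suc n)"
    unfolding sum_pmf_bipartite_on_with sum_pmf_bipartite_on
    by (simp add: mean_weight_def mult_ac)
  finally show ?thesis .
qed

lemma likelihood_balanced_less:
  assumes "4 \<le> n" "a < n div 2"
  shows "likelihood (complete_bipartite (n div 2) (n - n div 2)) <
    likelihood (complete_bipartite a (n - a))"
proof -
  have "a < n - a" "a + (n - a) = n" using assms(2) by presburger+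
  then have La: "likelihood (complete_bipartite a (n - a)) = path_weight n a / fact n"
    using likelihood_complete_bipartite[of a "n - a"] by metis
  show ?thesis
  proof (cases "even n")
    case True
    define h where "h = n div 2 - 1"
    have h: "n = Suc (2 * h + 1)" "1 \<le> h" "a \<le> h" "n div 2 = Suc h" "n - Suc h = Suc h"
      using assms True unfolding h_def by presburger+
    have "likelihood (complete_bipartite (Suc h) (Suc h)) = mean_weight (2 * h + 1) h / fact n"
      using likelihood_complete_bipartite_balanced[of "2 * h + 1" h] h(1) by simp
    moreover have "mean_weight (2 * h + 1) h < path_weight n a"
      unfolding h(1) using h(2,3) by (rule mean_weight_less_path_weight)
    ultimately show ?thesis unfolding La h(4,5) by (simp add: divide_strict_right_mono)
  next
    case False
    then obtain h where n: "n = Suc (2 * h)" by (auto elim: oddE)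
    have mid: "n div 2 = h" "n - h = Suc h" by (simp_all add: n)
    have h: "2 \<le> h" "a < h" using assms unfolding mid by (simp_all add: n)
    have "likelihood (complete_bipartite h (Suc h)) = path_weight n h / fact n"
      using likelihood_complete_bipartite[of h "Suc h"] by (simp add: n mult_2 del: fact_Suc path_weight.simps)
    moreover have "path_weight n h < path_weight n a"
      unfolding n using h by (rule path_weight_centre_less)
    ultimately show ?thesis unfolding La mid by (simp add: divide_strict_right_mono)
  qed
qed

theorem theorem2:
  fixes n :: nat
  assumes "n \<ge> 4"
  shows "\<forall>m. is_arg_min (\<lambda>a. likelihood (complete_bipartite a (n - a))) (\<lambda>a. a \<le> n div 2) m
           \<longleftrightarrow> m = n div 2"
proof (intro allI iffI)
  fix m
  let ?L = "\<lambda>a. likelihood (complete_bipartite a (n - a))"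
  assume min: "is_arg_min ?L (\<lambda>a. a \<le> n div 2) m"
  then have "\<not> ?L (n div 2) < ?L m" "m \<le> n div 2" by (auto simp: is_arg_min_def)
  then show "m = n div 2" using likelihood_balanced_less[OF assms, of m] le_neq_implies_less by blast
next
  fix m
  let ?L = "\<lambda>a. likelihood (complete_bipartite a (n - a))"
  assume m: "m = n div 2"
  have "\<not> ?L a < ?L m" if "a \<le> n div 2" for a
  proof (cases "a = n div 2")
    case True
    then show ?thesis unfolding m by simp
  next
    case False
    with that have "a < n div 2" by (rule le_neq_implies_less)
    from likelihood_balanced_less[OF assms this] show ?thesis unfolding m by (rule less_not_sym)
  qed
  then show "is_arg_min ?L (\<lambda>a. a \<le> n div 2) m" unfolding is_arg_min_def m by blast
qed

end
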